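(* For a positive integer $t$ and an integer $x\ge0$, let $\mathcal{D}_{t;x}$ be the set of $t$-core partitions with distinct parts whose largest part is $x$ (with $\mathcal{D}_{t;0}=\{\emptyset\}$). For positive integers $t,l$, let $\mathcal{D}'_{t;l}$ be the set of $t$-core partitions into exactly $l$ distinct parts. Then: (1) for all positive integers $t,l$, $$|\mathcal{D}'_{t;l}|=\sum_{i\ge1}\binom{t-i}{i}\binom{l-1}{i-1};$$ (2) for all integers $t\ge3$ and $2\le x\le t$, $$|\mathcal{D}_{t;x}|=|\mathcal{D}_{t-1;x-1}|+|\mathcal{D}_{t-2;x-1}|,$$ and moreover $|\mathcal{D}_{t;0}|=1$ for $t\ge1$, $|\mathcal{D}_{t;1}|=1$ for $t\ge2$, $|\mathcal{D}_{1;x}|=0$ for $x\ge1$, and $|\mathcal{D}_{2;x}|=1$ for $x\ge1$. In particular, $|\mathcal{D}_{t;x}|=2^{x-1}$ if $1\le x\le t/2$.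
   Context: A partition is a finite nonincreasing sequence of positive integers (its parts); the empty partition $\emptyset$ is allowed and is a $t$-core for every $t$. The Ferrers diagram of $\lambda$ has $\lambda_j$ nodes in row $j$ (left justified); the hook length of a node is the number of nodes consisting of the node itself, the nodes to its right in the same row and the nodes below it in the same column. $\lambda$ is a $t$-core partition if no node has hook length $t$ (equivalently, no hook length is divisible by $t$). Convention: $\binom{n}{k}=0$ when $n<k$, including negative $n$ (here $k\ge 0$). *)

theory Defs
  imports "HOL-Analysis.Infinite_Sum"
begin

definition is_partition :: "nat list \<Rightarrow> bool" where
  "is_partition ps \<longleftrightarrow> sorted_wrt (\<ge>) ps \<and> (\<forall>p\<in>set ps. 0 < p)"

text \<open>Nodes are pairs (row, column), both counted from 0.\<close>

definition ferrers :: "nat list \<Rightarrow> (nat \<times> nat) set" where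
  "ferrers ps = {(i, j). i < length ps \<and> j < ps ! i}"

definition hook :: "nat list \<Rightarrow> nat \<times> nat \<Rightarrow> (nat \<times> nat) set" where
  "hook ps = (\<lambda>(i, j). {(i', j') \<in> ferrers ps. (i' = i \<and> j \<le> j') \<or> (j' = j \<and> i \<le> i')})"

definition hook_length :: "nat list \<Rightarrow> nat \<times> nat \<Rightarrow> nat" where
  "hook_length ps v = card (hook ps v)"

definition t_core :: "nat \<Rightarrow> nat list \<Rightarrow> bool" where
  "t_core t ps \<longleftrightarrow> (\<forall>v\<in>ferrers ps. hook_length ps v \<noteq> t)"

text \<open>The empty partition gets largest part 0; see \<open>D_0\<close> below.\<close>

definition largest_part :: "nat list \<Rightarrow> nat" where
  "largest_part ps = Max (insert 0 (set ps))"

definition D :: "nat \<Rightarrow> nat \<Rightarrow> nat list set" where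
  "D t x = {ps. is_partition ps \<and> distinct ps \<and> t_core t ps \<and> largest_part ps = x}"

definition D' :: "nat \<Rightarrow> nat \<Rightarrow> nat list set" where
  "D' t l = {ps. is_partition ps \<and> distinct ps \<and> t_core t ps \<and> length ps = l}"

text \<open>The upper argument may be negative, in which case the value is 0.\<close>

definition binom :: "int \<Rightarrow> nat \<Rightarrow> nat" where
  "binom n k = (if n < int k then 0 else nat n choose k)"

lemma D_0: "D t 0 = {[]}"
proof -
  have "ps = []" if "is_partition ps" "largest_part ps = 0" for ps
  proof (rule ccontr)
    assume "ps \<noteq> []"
    then obtain p where p: "p \<in> set ps" by (meson list.set_sel(1))
    then have "p \<le> largest_part ps" by (simp add: largest_part_def)
    with p that show False by (auto simp: is_partition_def)
  qed
  then show ?thesis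
    by (auto simp: D_def is_partition_def t_core_def ferrers_def largest_part_def)
qed

lemma finite_D: "finite (D t x)"
proof -
  have "D t x \<subseteq> {ps. set ps \<subseteq> {..x} \<and> distinct ps}"
    by (auto simp: D_def largest_part_def)
  then show ?thesis
    using finite_subset finite_subset_distinct[of "{..x}"] by blast
qed

text \<open>Only finitely many terms of the sum in the theorem are nonzero.\<close>

lemma binom_infsum_eq_sum:
  "(\<Sum>\<^sub>\<infinity>i\<in>{1..}. binom (int t - int i) i * binom (int l - 1) (i - 1))
    = (\<Sum>i = 1..t. binom (int t - int i) i * binom (int l - 1) (i - 1))"
  (is "infsum ?f _ = _")
proof -
  have "infsum ?f {1..} = infsum ?f {1..t}"
    by (rule infsum_cong_neutral) (auto simp: binom_def)
  then show ?thesis by simp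
qed

end

theory Submission
  imports Defs
begin

text \<open>
  To a partition with distinct parts one associates the set of hook lengths of its first column,
  here called its beads. Distinctness of the parts means that this set is sparse: it contains
  neither \<open>0\<close> nor two consecutive numbers. The hook lengths of a row are the
  differences between its bead and the smaller natural numbers that are not beads
  (\<open>gaps_below_bead\<close>, \<open>hook_eq_bead_minus_gap\<close>), so the partition is a
  \<open>t\<close>-core iff its bead set is closed under subtracting \<open>t\<close>
  (\<open>t_core_iff_closed_down\<close>). The number of parts is the number of beads, and the
  largest part is the number of gaps below the largest bead. Both counts are therefore counts of
  closed sparse sets.

  For a prescribed number \<open>l\<close> of parts, sort the beads by their residue modulo
  \<open>t\<close>. A closed set is determined by the number of beads in each residue class, and
  it is sparse iff the list of these numbers starts with \<open>0\<close> and has no two adjacent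
  nonzero entries (\<open>bij_betw_abacus\<close>, \<open>sparse_abacus_iff\<close>). Cutting such
  a list into blocks \<open>0\<close> and \<open>0, n\<close> with \<open>n > 0\<close>, of which
  \<open>i\<close> are of the second kind, gives \<open>t - i\<close> blocks. There are \<open>t -
  i\<close> over \<open>i\<close> ways to place the long blocks and \<open>l - 1\<close> over
  \<open>i - 1\<close> ways to write \<open>l\<close> as a sum of their \<open>i\<close> positive
  entries (\<open>card_abacus_lists\<close>).

  For a prescribed largest part \<open>x\<close>, read the indicator word of the bead set up to
  the largest bead. It is a concatenation of exactly \<open>x\<close> blocks \<open>False\<close>
  and \<open>False, True\<close>, the last one being \<open>False, True\<close>. If the word has
  length \<open>L\<close>, then the position \<open>L - t\<close> is the start of a block, because
  the final \<open>True\<close> forces a \<open>True\<close> just before it (for \<open>L \<le>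
  t\<close> one takes the position \<open>0\<close>). Removing the block that starts there lowers
  \<open>x\<close> by one, and lowers \<open>L\<close> and \<open>t\<close> by the length of the
  block, so that the position of the cut stays the same and the removal can be undone. For
  \<open>x \<le> t\<close> it preserves and reflects the core condition
  (\<open>core_word_remove_block\<close>). The two possible lengths of the removed block give the
  two terms of the recurrence. If \<open>2 * x \<le> t\<close>, the words are too short for the
  core condition to say anything, which gives the power of two.
\<close>

section \<open>Hook lengths and beads\<close>

text \<open>
  The element of the bead set that belongs to the part \<open>p\<close> of a partition with set of
  parts \<open>S\<close>. It is the hook length of the first node of the row of \<open>p\<close>:
  that row has \<open>p\<close> nodes, and the smaller parts are the rows below.
\<close>

definition bead :: "nat set \<Rightarrow> nat \<Rightarrow> nat" where
  "bead S p = p + card (S \<inter> {..<p})"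

definition beads :: "nat set \<Rightarrow> nat set" where
  "beads S = bead S ` S"

definition sparse :: "nat set \<Rightarrow> bool" where
  "sparse X \<longleftrightarrow> finite X \<and> 0 \<notin> X \<and> (\<forall>i\<in>X. Suc i \<notin> X)"

definition closed_down :: "nat \<Rightarrow> nat set \<Rightarrow> bool" where
  "closed_down t X \<longleftrightarrow> (\<forall>i. i + t \<in> X \<longrightarrow> i \<in> X)"

text \<open>
  The rows below row \<open>i\<close> that reach column \<open>j\<close> correspond to the smaller
  parts exceeding \<open>j\<close>. Since the parts are distinct, the leg of a node depends only
  on the set of parts.
\<close>

lemma hook_length_distinct:
  assumes "sorted_wrt (>) ps" "i < length ps" "j < ps ! i"
  shows "hook_length ps (i, j) = ps ! i - j + card (set ps \<inter> {j<..<ps ! i})"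
proof -
  let ?leg = "{i'. i < i' \<and> i' < length ps \<and> j < ps ! i'}"
  have dec: "ps ! b < ps ! a" if "a < b" "b < length ps" for a b
    using assms(1) that by (simp add: sorted_wrt_iff_nth_less)
  have "hook ps (i, j) = Pair i ` {j..<ps ! i} \<union> (\<lambda>i'. (i', j)) ` ?leg"
    using assms(2,3) by (auto simp: hook_def ferrers_def le_less)
  moreover have "card (Pair i ` {j..<ps ! i} \<union> (\<lambda>i'. (i', j)) ` ?leg)
      = card (Pair i ` {j..<ps ! i}) + card ((\<lambda>i'. (i', j)) ` ?leg)"
    by (rule card_Un_disjoint) auto
  moreover have "card (Pair i ` {j..<ps ! i}) = ps ! i - j"
    by (subst card_image) (auto simp: inj_on_def)
  moreover have "card ((\<lambda>i'. (i', j)) ` ?leg) = card ?leg"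
    by (rule card_image) (auto simp: inj_on_def)
  ultimately have "hook_length ps (i, j) = (ps ! i - j) + card ?leg"
    unfolding hook_length_def by simp
  moreover have "bij_betw ((!) ps) ?leg (set ps \<inter> {j<..<ps ! i})"
  proof (rule bij_betw_imageI)
    show "inj_on ((!) ps) ?leg"
      by (rule inj_onI) (metis (mono_tags, lifting) dec mem_Collect_eq less_irrefl linorder_neqE_nat)
    show "(!) ps ` ?leg = set ps \<inter> {j<..<ps ! i}"
    proof
      show "set ps \<inter> {j<..<ps ! i} \<subseteq> (!) ps ` ?leg"
      proof
        fix q assume q: "q \<in> set ps \<inter> {j<..<ps ! i}"
        then obtain k where k: "k < length ps" "q = ps ! k" by (auto simp: in_set_conv_nth)
        have "i < k" using q k dec[of k i] assms(2) by (cases i k rule: linorder_cases) auto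
        then show "q \<in> (!) ps ` ?leg" using q k by auto
      qed
    qed (auto simp: dec)
  qed
  ultimately show ?thesis by (simp add: bij_betw_same_card)
qed

lemma bead_less: "p < q \<Longrightarrow> bead S p < bead S q"
  unfolding bead_def by (rule add_less_le_mono) (auto intro: card_mono)

lemma bead_less_iff: "bead S p < bead S q \<longleftrightarrow> p < q"
  by (metis bead_less linorder_neqE_nat less_asym less_irrefl)

lemma inj_bead: "inj_on (bead S) A"
  by (rule inj_onI) (metis bead_less_iff linorder_neqE_nat less_irrefl)

text \<open>
  Two beads are never adjacent because of the distinctness of the parts: going from
  \<open>p\<close> to a larger part raises both summands of \<^const>\<open>bead\<close>.
\<close>

lemma bead_gap:
  assumes "p \<in> S" "p < q" shows "Suc (bead S p) < bead S q"
proof -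
  have "insert p (S \<inter> {..<p}) \<subseteq> S \<inter> {..<q}" using assms by auto
  then have "card (insert p (S \<inter> {..<p})) \<le> card (S \<inter> {..<q})" by (intro card_mono) auto
  then show ?thesis using assms(2) by (simp add: bead_def)
qed

lemma sparse_beads:
  assumes "finite S" "0 \<notin> S" shows "sparse (beads S)"
proof -
  have "Suc (bead S p) \<noteq> bead S q" if "p \<in> S" "q \<in> S" for p q
    using bead_gap[OF that(1), of q] bead_less_iff[of S p q] by (metis lessI less_irrefl)
  moreover have "bead S p \<noteq> 0" if "p \<in> S" for p
    using assms(2) that by (cases p) (auto simp: bead_def)
  ultimately show ?thesis using assms(1) by (force simp: sparse_def beads_def)
qed

lemma card_beads: "card (beads S) = card S"
  by (simp add: beads_def card_image inj_bead)

lemma card_beads_below: "card (beads S \<inter> {..<bead S p}) = card (S \<inter> {..<p})"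
proof -
  have "beads S \<inter> {..<bead S p} = bead S ` (S \<inter> {..<p})"
    by (auto simp: beads_def bead_less_iff)
  then show ?thesis by (simp add: card_image inj_bead)
qed

text \<open>
  A part is recovered from its bead as the number of gaps below the bead.
\<close>

definition unbead :: "nat set \<Rightarrow> nat \<Rightarrow> nat" where
  "unbead X x = x - card (X \<inter> {..<x})"

lemma unbead_bead: "unbead (beads S) (bead S p) = p"
  unfolding unbead_def card_beads_below by (simp add: bead_def)

lemma unbead_beads: "unbead (beads S) ` beads S = S"
proof -
  have "unbead (beads S) ` (bead S ` S) = (\<lambda>p. p) ` S"
    unfolding image_image by (rule image_cong) (simp_all only: unbead_bead)
  then show ?thesis by (simp flip: beads_def)
qed

lemma card_below_less:
  assumes "sparse X" "x \<in> X" shows "card (X \<inter> {..<x}) < x"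
proof -
  have "X \<inter> {..<x} \<subseteq> {1..<x}" using assms by (auto simp: sparse_def) (metis Suc_leI gr0I)
  then have "card (X \<inter> {..<x}) \<le> card {1..<x}" by (intro card_mono) auto
  moreover have "x > 0" using assms by (auto simp: sparse_def intro: gr0I)
  ultimately show ?thesis by simp
qed

text \<open>
  Between two beads of a sparse set there is a gap, so that counting the gaps below a bead is
  strictly monotone on beads. This is what makes the recovered parts distinct.
\<close>

lemma unbead_less:
  assumes "sparse X" "x \<in> X" "y \<in> X" "x < y"
  shows "unbead X x < unbead X y"
proof -
  have "y \<noteq> Suc x" using assms by (auto simp: sparse_def)
  then have y: "x + 2 \<le> y" using assms(4) by simp
  have "X \<inter> {..<y} \<subseteq> insert x (X \<inter> {..<x}) \<union> {x+2..<y}"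
  proof
    fix z assume z: "z \<in> X \<inter> {..<y}"
    then have "z \<noteq> Suc x" using assms by (auto simp: sparse_def)
    then show "z \<in> insert x (X \<inter> {..<x}) \<union> {x+2..<y}" using z by auto
  qed
  then have "card (X \<inter> {..<y}) \<le> card (insert x (X \<inter> {..<x}) \<union> {x+2..<y})"
    by (intro card_mono) auto
  also have "\<dots> \<le> card (insert x (X \<inter> {..<x})) + card {x+2..<y}" by (rule card_Un_le)
  finally have "card (X \<inter> {..<y}) \<le> Suc (card (X \<inter> {..<x})) + (y - (x + 2))" by simp
  then show ?thesis
    using card_below_less[OF assms(1,2)] y unfolding unbead_def by linarith
qed

text \<open>
  The set of parts is the set of all gap counts. By monotonicity the parts below \<open>unbead X
  x\<close> are as many as the beads below \<open>x\<close>, hence the bead of \<open>unbead X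
  x\<close> is \<open>x\<close> again.
\<close>

lemma beads_surj:
  assumes X: "sparse X"
  obtains S where "finite S" "0 \<notin> S" "beads S = X"
proof
  let ?S = "unbead X ` X"
  have mono: "unbead X x < unbead X y \<longleftrightarrow> x < y" if "x \<in> X" "y \<in> X" for x y
    using unbead_less[OF X] that by (metis linorder_neqE_nat less_asym less_irrefl)
  show "finite ?S" using X by (simp add: sparse_def)
  show "0 \<notin> ?S" using card_below_less[OF X] by (force simp: unbead_def)
  have "bead ?S (unbead X x) = x" if x: "x \<in> X" for x
  proof -
    have "?S \<inter> {..<unbead X x} = unbead X ` (X \<inter> {..<x})" using mono x by auto
    moreover have "inj_on (unbead X) (X \<inter> {..<x})"
      by (rule inj_onI) (metis IntD1 mono linorder_neqE_nat less_irrefl)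
    ultimately have "card (?S \<inter> {..<unbead X x}) = card (X \<inter> {..<x})"
      by (simp add: card_image)
    then show ?thesis
      using card_below_less[OF X x] by (simp add: bead_def unbead_def)
  qed
  then show "beads ?S = X" by (force simp: beads_def)
qed

text \<open>
  The gaps are indexed by the columns: column \<open>j\<close> contributes \<open>j\<close> plus
  the number of parts that do not reach beyond it. These values avoid all beads and are strictly
  increasing in \<open>j\<close>, and counting shows that they exhaust the gaps: below \<open>bead
  S p\<close> there are exactly \<open>p\<close> gaps.
\<close>

lemma gaps_below_bead:
  assumes "finite S"
  shows "{..<bead S p} - beads S = (\<lambda>j. j + card (S \<inter> {..j})) ` {..<p}"
proof (rule sym, rule card_subset_eq)
  let ?g = "\<lambda>j. j + card (S \<inter> {..j})"
  have mono: "?g i < ?g j" if "i < j" for i j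
    using that assms by (intro add_less_le_mono card_mono) auto
  have below: "?g j < bead S q" if "j < q" for j q
    unfolding bead_def using that by (intro add_less_le_mono card_mono) auto
  have above: "bead S q < ?g j" if "q \<in> S" "q \<le> j" for j q
  proof -
    have "insert q (S \<inter> {..<q}) \<subseteq> S \<inter> {..j}" using that by auto
    then have "card (insert q (S \<inter> {..<q})) \<le> card (S \<inter> {..j})"
      using assms by (intro card_mono) auto
    then show ?thesis using that(2) by (simp add: bead_def)
  qed
  have "?g j \<noteq> bead S q" if "q \<in> S" for j q
    using above[OF that, of j] below[of j q] by (cases "q \<le> j") auto
  then show "?g ` {..<p} \<subseteq> {..<bead S p} - beads S"
    using below by (auto simp: beads_def)
  have "inj_on ?g {..<p}"
    by (rule inj_onI) (metis mono linorder_neqE_nat less_irrefl)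
  then have "card (?g ` {..<p}) = p" by (simp add: card_image)
  moreover have "card ({..<bead S p} - beads S) = bead S p - card (S \<inter> {..<p})"
    using card_beads_below[of S p] by (simp add: card_Diff_subset_Int Int_commute)
  ultimately show "card (?g ` {..<p}) = card ({..<bead S p} - beads S)"
    by (simp add: bead_def)
qed simp

text \<open>
  The left-hand side is the hook length in column \<open>j\<close> of the row of \<open>p\<close>,
  so the hook lengths of a row are the distances from its bead down to the gaps.
\<close>

lemma hook_eq_bead_minus_gap:
  assumes "finite S" "j < p"
  shows "p - j + card (S \<inter> {j<..<p}) = bead S p - (j + card (S \<inter> {..j}))"
proof -
  have "S \<inter> {..<p} = (S \<inter> {..j}) \<union> (S \<inter> {j<..<p})" using assms(2) by auto
  moreover have "card \<dots> = card (S \<inter> {..j}) + card (S \<inter> {j<..<p})"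
    using assms(1) by (intro card_Un_disjoint) auto
  ultimately show ?thesis using assms(2) by (simp add: bead_def)
qed

lemma distinct_partition_iff:
  "is_partition ps \<and> distinct ps \<longleftrightarrow> sorted_wrt (>) ps \<and> 0 \<notin> set ps"
proof -
  have "sorted_wrt (\<ge>) ps \<and> distinct ps \<longleftrightarrow> sorted_wrt (>) ps"
    by (induction ps) (auto simp: le_less)
  then show ?thesis by (auto simp: is_partition_def intro: gr0I)
qed

text \<open>
  A node of hook length \<open>t\<close> is a bead \<open>x\<close> together with a gap at
  \<open>x - t\<close>.
\<close>

lemma t_core_iff_closed_down:
  assumes ps: "is_partition ps" "distinct ps" and t: "1 \<le> t"
  shows "t_core t ps \<longleftrightarrow> closed_down t (beads (set ps))"
proof -
  let ?S = "set ps"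
  have dec: "sorted_wrt (>) ps" using ps distinct_partition_iff by blast
  have "t_core t ps \<longleftrightarrow> (\<forall>p\<in>?S. \<forall>j<p. p - j + card (?S \<inter> {j<..<p}) \<noteq> t)"
    using dec by (auto simp: t_core_def ferrers_def all_set_conv_all_nth hook_length_distinct)
  also have "\<dots> \<longleftrightarrow> (\<forall>p\<in>?S. \<forall>j<p. bead ?S p - (j + card (?S \<inter> {..j})) \<noteq> t)"
    using hook_eq_bead_minus_gap[of ?S] by (metis List.finite_set)
  also have "\<dots> \<longleftrightarrow> (\<forall>p\<in>?S. \<forall>g\<in>{..<bead ?S p} - beads ?S. bead ?S p - g \<noteq> t)"
    by (subst gaps_below_bead) auto
  also have "\<dots> \<longleftrightarrow> (\<forall>x\<in>beads ?S. \<forall>g. g < x \<and> g \<notin> beads ?S \<longrightarrow> x - g \<noteq> t)"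
    by (auto simp: beads_def)
  also have "\<dots> \<longleftrightarrow> closed_down t (beads ?S)"
    (is "?L \<longleftrightarrow> _")
  proof
    assume L: ?L
    show "closed_down t (beads ?S)"
      unfolding closed_down_def
    proof (intro allI impI)
      fix i assume "i + t \<in> beads ?S"
      then show "i \<in> beads ?S" using L t by (metis add_diff_cancel_left' less_add_same_cancel1 less_le_trans zero_less_one)
    qed
  next
    assume "closed_down t (beads ?S)"
    then show ?L unfolding closed_down_def by (metis le_add_diff_inverse less_imp_le)
  qed
  finally show ?thesis .
qed

lemma bij_betw_beads:
  "bij_betw (\<lambda>ps. beads (set ps)) {ps. is_partition ps \<and> distinct ps} {X. sparse X}"
proof (rule bij_betw_imageI)
  show "inj_on (\<lambda>ps. beads (set ps)) {ps. is_partition ps \<and> distinct ps}"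
  proof (rule inj_onI)
    fix ps qs
    assume *: "ps \<in> {ps. is_partition ps \<and> distinct ps}" "qs \<in> {ps. is_partition ps \<and> distinct ps}"
      and eq: "beads (set ps) = beads (set qs)"
    have "set ps = unbead (beads (set ps)) ` beads (set ps)" by (simp only: unbead_beads)
    also have "\<dots> = set qs" unfolding eq by (rule unbead_beads)
    finally have "set ps = set qs" .
    moreover have "sorted (rev ps)" "sorted (rev qs)"
      using * by (auto simp: is_partition_def sorted_wrt_rev)
    ultimately show "ps = qs"
      using sorted_distinct_set_unique[of "rev ps" "rev qs"] * by auto
  qed
  show "(\<lambda>ps. beads (set ps)) ` {ps. is_partition ps \<and> distinct ps} = {X. sparse X}"
  proof (intro equalityI subsetI)
    fix X assume "X \<in> {X. sparse X}"
    then obtain S where S: "finite S" "0 \<notin> S" "beads S = X" using beads_surj by blast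
    let ?ps = "rev (sorted_list_of_set S)"
    have "is_partition ?ps \<and> distinct ?ps" "set ?ps = S"
      using S by (auto simp: is_partition_def sorted_wrt_rev intro: gr0I)
    then show "X \<in> (\<lambda>ps. beads (set ps)) ` {ps. is_partition ps \<and> distinct ps}"
      using S(3) by (intro image_eqI[of _ _ ?ps]) auto
  qed (auto simp: is_partition_def intro: sparse_beads)
qed

lemma bij_betw_Collect_cong:
  assumes "bij_betw f {a. P a} {b. Q b}" "\<And>a. P a \<Longrightarrow> P' a \<longleftrightarrow> Q' (f a)"
  shows "bij_betw f {a. P a \<and> P' a} {b. Q b \<and> Q' b}"
proof (rule bij_betw_imageI)
  show "inj_on f {a. P a \<and> P' a}"
    by (rule inj_on_subset[OF bij_betw_imp_inj_on[OF assms(1)]]) auto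
  have im: "f ` {a. P a} = {b. Q b}" using assms(1) by (rule bij_betw_imp_surj_on)
  show "f ` {a. P a \<and> P' a} = {b. Q b \<and> Q' b}"
  proof (intro equalityI subsetI)
    fix b assume b: "b \<in> {b. Q b \<and> Q' b}"
    then have "b \<in> f ` {a. P a}" using im by simp
    then obtain a where "P a" "b = f a" by auto
    then show "b \<in> f ` {a. P a \<and> P' a}" using assms(2) b by auto
  next
    fix b assume "b \<in> f ` {a. P a \<and> P' a}"
    then obtain a where a: "P a" "P' a" "b = f a" by auto
    then have "b \<in> {b. Q b}" using im by blast
    then show "b \<in> {b. Q b \<and> Q' b}" using assms(2)[OF a(1)] a by simp
  qed
qed

lemma bij_betw_D'_beads:
  assumes "1 \<le> t"
  shows "bij_betw (\<lambda>ps. beads (set ps)) (D' t l) {X. sparse X \<and> closed_down t X \<and> card X = l}"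
proof -
  have "bij_betw (\<lambda>ps. beads (set ps))
      {ps. (is_partition ps \<and> distinct ps) \<and> t_core t ps \<and> length ps = l}
      {X. sparse X \<and> closed_down t X \<and> card X = l}"
  proof (rule bij_betw_Collect_cong[OF bij_betw_beads,
        where P' = "\<lambda>ps. t_core t ps \<and> length ps = l" and Q' = "\<lambda>X. closed_down t X \<and> card X = l"])
    fix ps assume "is_partition ps \<and> distinct ps"
    then show "(t_core t ps \<and> length ps = l) \<longleftrightarrow>
        (closed_down t (beads (set ps)) \<and> card (beads (set ps)) = l)"
      using t_core_iff_closed_down[OF _ _ assms, of ps] by (simp add: card_beads distinct_card)
  qed
  then show ?thesis unfolding D'_def by (simp only: conj_assoc)
qed

text \<open>
  The largest bead belongs to the largest part, and every other part lies below it, so the beads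
  below it number one less than the parts. The right-hand side is the number of gaps below the
  largest bead.
\<close>

lemma largest_part_eq:
  assumes ps: "is_partition ps" "distinct ps" "ps \<noteq> []"
  shows "largest_part ps = Suc (Max (beads (set ps))) - length ps"
proof -
  let ?S = "set ps" and ?m = "Max (set ps)"
  have m: "?m \<in> ?S" "\<And>q. q \<in> ?S \<Longrightarrow> q \<le> ?m" using ps(3) by (simp_all add: Max_ge)
  have "Max (beads ?S) = bead ?S ?m"
  proof (rule Max_eqI)
    fix y assume "y \<in> beads ?S"
    then obtain q where "q \<in> ?S" "y = bead ?S q" by (auto simp: beads_def)
    then show "y \<le> bead ?S ?m" using m(2)[of q] bead_less_iff[of ?S ?m q] by linarith
  next
    show "bead ?S ?m \<in> beads ?S" unfolding beads_def using m(1) by (rule imageI)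
  qed (simp add: beads_def)
  moreover have "?S = insert ?m (?S \<inter> {..<?m})" using m(1) le_neq_implies_less[OF m(2)] by blast
  then have "card ?S = card (insert ?m (?S \<inter> {..<?m}))" by (rule arg_cong)
  then have "card ?S = Suc (card (?S \<inter> {..<?m}))" by (subst (asm) card_insert_disjoint) auto
  moreover have "card ?S = length ps" using ps(2) by (rule distinct_card)
  moreover have "largest_part ps = ?m" using ps(3) by (simp add: largest_part_def)
  ultimately show ?thesis by (simp add: bead_def)
qed

section \<open>Separated lists and their block decomposition\<close>

text \<open>
  Block decomposition read backwards: \<open>xs\<close> lists the blocks, and the nonempty lists
  obtained are those that start with \<open>z\<close> and have no two adjacent entries different
  from \<open>z\<close>. With \<open>z = 0\<close> these are the runner counts of an abacus, and
  with \<open>z = False\<close> the indicator words of sparse sets.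
\<close>

definition spread :: "'a \<Rightarrow> 'a list \<Rightarrow> 'a list" where
  "spread z xs = concat (map (\<lambda>a. if a = z then [z] else [z, a]) xs)"

definition separated :: "'a \<Rightarrow> 'a list \<Rightarrow> bool" where
  "separated z ys \<longleftrightarrow> (ys \<noteq> [] \<longrightarrow> hd ys = z) \<and> successively (\<lambda>a b. a = z \<or> b = z) ys"

lemma spread_simps [simp]:
  "spread z [] = []"
  "spread z (a # xs) = (if a = z then z # spread z xs else z # a # spread z xs)"
  "spread z (xs @ ys) = spread z xs @ spread z ys"
  by (simp_all add: spread_def)

lemma spread_eq_Nil_iff [simp]: "spread z xs = [] \<longleftrightarrow> xs = []"
  by (cases xs) auto

lemma spread_neq_Cons: "a \<noteq> z \<Longrightarrow> spread z xs \<noteq> a # ys"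
  by (cases xs) auto

lemma filter_spread: "filter (\<lambda>a. a \<noteq> z) (spread z xs) = filter (\<lambda>a. a \<noteq> z) xs"
  by (induction xs) auto

lemma length_spread: "length (spread z xs) = length xs + length (filter (\<lambda>a. a \<noteq> z) xs)"
  by (induction xs) auto

lemma sum_list_spread_0: "sum_list (spread 0 ns) = sum_list (ns :: nat list)"
  by (induction ns) auto

lemma spread_inject: "spread z xs = spread z ys \<Longrightarrow> xs = ys"
proof (induction xs arbitrary: ys)
  case (Cons a xs)
  then show ?case
    by (cases ys) (auto split: if_splits simp: spread_neq_Cons spread_neq_Cons[symmetric])
qed (metis spread_eq_Nil_iff)

lemma separated_Cons_Cons:
  "separated z (a # b # ys) \<longleftrightarrow> a = z \<and> (if b = z then separated z (z # ys) else separated z ys)"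
  by (cases ys) (auto simp: separated_def)

lemma separated_spread: "separated z (spread z xs)"
proof (induction xs)
  case (Cons a xs)
  then show ?case
    by (cases "spread z xs") (auto simp: separated_def)
qed (simp add: separated_def)

text \<open>
  Blocks are split off from the left. In a list \<open>z # b # ys\<close> either \<open>b =
  z\<close> and the first block is the single \<open>z\<close>, or the first block is \<open>z,
  b\<close> and \<open>ys\<close> starts with \<open>z\<close> again; both remainders are shorter
  and separated.
\<close>

lemma separated_imp_spread:
  assumes "separated z ys" shows "\<exists>xs. ys = spread z xs"
  using assms
proof (induction ys rule: length_induct)
  case (1 ys)
  consider "ys = []" | a where "ys = [a]" | a b zs where "ys = a # b # zs"
    by (metis list.exhaust)
  then show ?case
  proof cases
    case 1 then show ?thesis by (metis spread_simps(1))
  next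
    case 2 then show ?thesis using "1.prems"
      by (intro exI[of _ "[z]"]) (simp add: separated_def)
  next
    case 3
    show ?thesis
    proof (cases "b = z")
      case True
      then have "separated z (z # zs)" "a = z" using "1.prems" 3 by (auto simp: separated_Cons_Cons)
      then obtain xs where "z # zs = spread z xs" using "1.IH" 3 by fastforce
      then show ?thesis using True 3 \<open>a = z\<close> by (intro exI[of _ "z # xs"]) simp
    next
      case False
      then have "separated z zs" "a = z" using "1.prems" 3 by (auto simp: separated_Cons_Cons)
      then obtain xs where "zs = spread z xs" using "1.IH" 3 by fastforce
      then show ?thesis using False 3 \<open>a = z\<close> by (intro exI[of _ "b # xs"]) simp
    qed
  qed
qed

lemma separated_nth:
  "separated z ys \<longleftrightarrow> (ys \<noteq> [] \<longrightarrow> ys ! 0 = z) \<and>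
     (\<forall>i. Suc i < length ys \<longrightarrow> ys ! i = z \<or> ys ! Suc i = z)"
  by (auto simp: separated_def successively_conv_nth hd_conv_nth)

section \<open>The abacus of a core\<close>

text \<open>
  Runner \<open>r\<close> of the abacus consists of the numbers congruent to \<open>r\<close>
  modulo the number of runners; on it the \<open>c ! r\<close> smallest positions carry beads. The
  empty list has no runners; it is treated separately because \<open>x div 0 = 0\<close> would
  otherwise refer to nonexistent entries.
\<close>

definition abacus :: "nat list \<Rightarrow> nat set" where
  "abacus c = {x. c \<noteq> [] \<and> x div length c < c ! (x mod length c)}"

lemma abacus_mem: "r < length c \<Longrightarrow> r + k * length c \<in> abacus c \<longleftrightarrow> k < c ! r"
  by (cases "c = []") (simp_all add: abacus_def)

lemma abacus_eq_image:
  "abacus c = (\<lambda>(r, k). r + k * length c) ` (SIGMA r:{..<length c}. {..<c ! r})"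
proof (intro equalityI subsetI)
  fix x assume x: "x \<in> abacus c"
  have "x = x mod length c + x div length c * length c" by simp
  then show "x \<in> (\<lambda>(r, k). r + k * length c) ` (SIGMA r:{..<length c}. {..<c ! r})"
    using x by (intro image_eqI[of _ _ "(x mod length c, x div length c)"]) (auto simp: abacus_def)
qed (auto simp: abacus_mem)

lemma finite_abacus: "finite (abacus c)"
  unfolding abacus_eq_image by blast

lemma card_abacus: "card (abacus c) = sum_list c"
proof -
  have "inj_on (\<lambda>(r, k). r + k * length c) (SIGMA r:{..<length c}. {..<c ! r})"
  proof (rule inj_onI, clarsimp)
    fix r k r' k' assume "r < length c" "r' < length c" and eq: "r + k * length c = r' + k' * length c"
    have div: "(a + b * length c) div length c = b" if "a < length c" for a b
      using that by (cases "c = []") simp_all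
    have "k = k'" using arg_cong[OF eq, of "\<lambda>x. x div length c"]
      unfolding div[OF \<open>r < length c\<close>] div[OF \<open>r' < length c\<close>] .
    with eq show "r = r' \<and> k = k'" by simp
  qed
  then have "card (abacus c) = (\<Sum>r<length c. c ! r)"
    unfolding abacus_eq_image by (subst card_image) auto
  then show ?thesis by (simp add: sum_list_sum_nth atLeast0LessThan)
qed

lemma closed_down_abacus: "closed_down (length c) (abacus c)"
  by (auto simp: closed_down_def abacus_def)

text \<open>
  Adjacent beads in the same period lie on adjacent runners, and conversely two adjacent runners
  with beads already have adjacent beads in the lowest period. Adjacent beads in different periods
  would need a bead on runner \<open>0\<close>, which is empty.
\<close>

lemma sparse_abacus_iff:
  "sparse (abacus c) \<longleftrightarrow> separated 0 c"
proof
  assume sp: "sparse (abacus c)"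
  have *: "r \<in> abacus c \<longleftrightarrow> 0 < c ! r" if "r < length c" for r
    using abacus_mem[OF that, of 0] by simp
  have "c ! 0 = 0" if "c \<noteq> []" using sp *[of 0] that by (simp add: sparse_def)
  moreover have "c ! i = 0 \<or> c ! Suc i = 0" if "Suc i < length c" for i
    using sp *[of i] *[of "Suc i"] that by (auto simp: sparse_def)
  ultimately show "separated 0 c" by (simp add: separated_nth)
next
  assume sep: "separated 0 c"
  \<comment> \<open>The first case is the passage from the last runner to runner 0 of the next period.\<close>
  have "Suc x \<notin> abacus c" if x: "x \<in> abacus c" for x
  proof (cases "Suc (x mod length c) = length c")
    case True
    then have "Suc x mod length c = 0" by (simp add: mod_Suc)
    then show ?thesis using sep by (auto simp: abacus_def separated_nth)
  next
    case False
    from x have "c \<noteq> []" by (simp add: abacus_def)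
    then have "Suc (x mod length c) < length c"
      using False mod_less_divisor[of "length c" x] by (simp del: mod_less_divisor)
    moreover have "Suc x mod length c = Suc (x mod length c)" using False by (simp add: mod_Suc)
    ultimately show ?thesis using sep x by (force simp: abacus_def separated_nth)
  qed
  then show "sparse (abacus c)"
    using sep by (auto simp: sparse_def finite_abacus) (auto simp: abacus_def separated_nth)
qed

lemma closed_down_nat_set:
  fixes K :: "nat set"
  assumes "finite K" "\<And>k. Suc k \<in> K \<Longrightarrow> k \<in> K"
  shows "k \<in> K \<longleftrightarrow> k < card K"
proof -
  have down: "j \<in> K" if "k \<in> K" "j \<le> k" for j k
    using that(2,1) by (induction rule: inc_induct) (auto intro: assms(2))
  show ?thesis
  proof
    assume "k \<in> K"
    then have "{..k} \<subseteq> K" using down by auto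
    then show "k < card K" using card_mono[OF assms(1), of "{..k}"] by simp
  next
    assume "k < card K"
    show "k \<in> K"
    proof (rule ccontr)
      assume "k \<notin> K"
      then have "K \<subseteq> {..<k}" using down by (meson lessThan_iff linorder_not_less subsetI)
      then have "card K \<le> k" using card_mono[of "{..<k}" K] by simp
      with \<open>k < card K\<close> show False by simp
    qed
  qed
qed

lemma abacus_surj:
  assumes t: "1 \<le> t" and X: "finite X" "closed_down t X"
  obtains c where "length c = t" "abacus c = X"
proof
  let ?K = "\<lambda>r. {k. r + k * t \<in> X}"
  let ?c = "map (\<lambda>r. card (?K r)) [0..<t]"
  show len: "length ?c = t" by simp
  have K: "k < card (?K r) \<longleftrightarrow> r + k * t \<in> X" for r k
  proof -
    have "finite (?K r)"
      by (rule finite_imageD[of "\<lambda>k. r + k * t"])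
        (use t X(1) in \<open>auto intro: finite_subset simp: inj_on_def\<close>)
    moreover have "Suc k \<in> ?K r \<Longrightarrow> k \<in> ?K r" for k
      using X(2) by (auto simp: closed_down_def add_ac)
    ultimately show ?thesis using closed_down_nat_set[of "?K r" k] by simp
  qed
  show "abacus ?c = X"
  proof (rule set_eqI)
    fix x
    have "x mod t < t" using t by simp
    then have "x \<in> abacus ?c \<longleftrightarrow> x div t < card (?K (x mod t))"
      unfolding abacus_def len using t by auto
    then show "x \<in> abacus ?c \<longleftrightarrow> x \<in> X" unfolding K by simp
  qed
qed

text \<open>
  A set that is closed under subtracting \<open>t\<close> is pushed down on every runner, so it is
  determined by the number of beads on each runner.
\<close>

lemma bij_betw_abacus:
  assumes "1 \<le> t"
  shows "bij_betw abacus {c. length c = t \<and> separated 0 c \<and> sum_list c = l}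
           {X. sparse X \<and> closed_down t X \<and> card X = l}"
proof (rule bij_betw_imageI)
  show "inj_on abacus {c. length c = t \<and> separated 0 c \<and> sum_list c = l}"
  proof (rule inj_onI)
    fix c d
    assume c: "c \<in> {c. length c = t \<and> separated 0 c \<and> sum_list c = l}"
      and d: "d \<in> {c. length c = t \<and> separated 0 c \<and> sum_list c = l}" and eq: "abacus c = abacus d"
    from c d have len: "length c = t" "length d = t" by simp_all
    have "c ! r = d ! r" if "r < t" for r
    proof -
      have "k < c ! r \<longleftrightarrow> k < d ! r" for k
        using abacus_mem[of r c k] abacus_mem[of r d k] that unfolding len eq by simp
      from this[of "c ! r"] this[of "d ! r"] show ?thesis by simp
    qed
    then show "c = d" using len by (intro nth_equalityI) simp_all
  qed
  show "abacus ` {c. length c = t \<and> separated 0 c \<and> sum_list c = l}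
      = {X. sparse X \<and> closed_down t X \<and> card X = l}"
  proof (intro equalityI subsetI)
    fix X assume "X \<in> {X. sparse X \<and> closed_down t X \<and> card X = l}"
    then have X: "sparse X" "closed_down t X" "card X = l" by simp_all
    then obtain c where c: "length c = t" "abacus c = X"
      using abacus_surj[OF assms, of X] unfolding sparse_def by blast
    then have "separated 0 c" "sum_list c = l"
      using X card_abacus[of c] sparse_abacus_iff[of c] by simp_all
    then show "X \<in> abacus ` {c. length c = t \<and> separated 0 c \<and> sum_list c = l}"
      using c by blast
  next
    fix X assume "X \<in> abacus ` {c. length c = t \<and> separated 0 c \<and> sum_list c = l}"
    then obtain c where "length c = t" "separated 0 c" "sum_list c = l" "X = abacus c" by blast
    then show "X \<in> {X. sparse X \<and> closed_down t X \<and> card X = l}"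
      using closed_down_abacus[of c] by (simp add: card_abacus sparse_abacus_iff)
  qed
qed

section \<open>Counting cores by number of parts\<close>

lemma card_bool_lists:
  "card {bs. length bs = n \<and> length (filter (\<lambda>b. b) bs) = i} = n choose i"
proof (induction n arbitrary: i)
  case 0
  have "{bs :: bool list. length bs = 0 \<and> length (filter (\<lambda>b. b) bs) = i} = (if i = 0 then {[]} else {})"
    by auto
  then show ?case by (cases i) auto
next
  case (Suc n)
  let ?B = "\<lambda>n i. {bs. length bs = n \<and> length (filter (\<lambda>b. b) bs) = i}"
  have fin: "finite (?B n i)" for n i
    by (rule finite_subset[OF _ finite_lists_length_eq[of "UNIV :: bool set" n]]) auto
  show ?case
  proof (cases i)
    case 0
    have "?B (Suc n) 0 = Cons False ` ?B n 0"
    proof (rule set_eqI)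
      fix bs :: "bool list"
      show "bs \<in> ?B (Suc n) 0 \<longleftrightarrow> bs \<in> Cons False ` ?B n 0" by (cases bs) auto
    qed
    then show ?thesis using Suc.IH[of 0] 0 by (simp add: card_image)
  next
    case (Suc j)
    have "?B (Suc n) (Suc j) = Cons True ` ?B n j \<union> Cons False ` ?B n (Suc j)"
    proof (rule set_eqI)
      fix bs :: "bool list"
      show "bs \<in> ?B (Suc n) (Suc j) \<longleftrightarrow> bs \<in> Cons True ` ?B n j \<union> Cons False ` ?B n (Suc j)"
        by (cases bs) auto
    qed
    moreover have "Cons True ` ?B n j \<inter> Cons False ` ?B n (Suc j) = {}" by auto
    ultimately have "card (?B (Suc n) (Suc j)) = card (?B n j) + card (?B n (Suc j))"
      by (simp add: card_Un_disjoint fin card_image)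
    then show ?thesis using Suc.IH Suc by simp
  qed
qed

text \<open>
  Subtracting 1 from each of the \<open>i\<close> summands reduces the count of compositions of
  \<open>l\<close> to that of lists of \<open>i\<close> natural numbers with sum \<open>l -
  i\<close>.
\<close>

lemma card_compositions:
  assumes "1 \<le> l" "1 \<le> i"
  shows "card {ms :: nat list. length ms = i \<and> 0 \<notin> set ms \<and> sum_list ms = l} = (l - 1) choose (i - 1)"
proof (cases "i \<le> l")
  case True
  have sum_Suc: "sum_list (map Suc ks) = sum_list ks + length ks" for ks
    by (induction ks) auto
  have "{ms :: nat list. length ms = i \<and> 0 \<notin> set ms \<and> sum_list ms = l}
      = map Suc ` {ks. length ks = i \<and> sum_list ks = l - i}"
  proof (intro equalityI subsetI)
    fix ms :: "nat list" assume ms: "ms \<in> {ms. length ms = i \<and> 0 \<notin> set ms \<and> sum_list ms = l}"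
    have eq: "ms = map Suc (map (\<lambda>m. m - 1) ms)"
    proof -
      have "Suc (m - 1) = m" if "m \<in> set ms" for m using that ms by (cases "m = 0") auto
      then show ?thesis by (simp add: map_idI comp_def)
    qed
    have "sum_list (map (\<lambda>m. m - 1) ms) = l - i"
      using sum_Suc[of "map (\<lambda>m. m - 1) ms"] ms eq by simp
    then show "ms \<in> map Suc ` {ks. length ks = i \<and> sum_list ks = l - i}"
      using ms by (intro image_eqI[where x = "map (\<lambda>m. m - 1) ms"], intro eq) simp
  qed (use True in \<open>auto simp: sum_Suc\<close>)
  then have "card {ms :: nat list. length ms = i \<and> 0 \<notin> set ms \<and> sum_list ms = l}
      = card {ks :: nat list. length ks = i \<and> sum_list ks = l - i}"
    by (simp add: card_image inj_on_def)
  also have "\<dots> = (l - 1) choose (l - i)"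
    using True assms by (subst card_length_sum_list) simp
  also have "\<dots> = (l - 1) choose (i - 1)"
    using True assms by (subst binomial_symmetric) auto
  finally show ?thesis .
next
  case False
  have "length ms \<le> sum_list ms" if "0 \<notin> set ms" for ms :: "nat list"
    using that by (induction ms) auto
  then have empty: "{ms :: nat list. length ms = i \<and> 0 \<notin> set ms \<and> sum_list ms = l} = {}"
    using False by auto
  have "l - 1 < i - 1" using False assms by linarith
  then show ?thesis unfolding empty by (simp add: binomial_eq_0)
qed

lemma pattern_and_values_inject:
  assumes "map (\<lambda>n. n \<noteq> 0) ns = map (\<lambda>n. n \<noteq> 0) ms" "filter (\<lambda>n. n \<noteq> 0) ns = filter (\<lambda>n. n \<noteq> 0) ms"
  shows "(ns :: nat list) = ms"
proof -
  have "length ns = length ms" using assms(1) by (rule map_eq_imp_length_eq)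
  then show ?thesis using assms by (induction rule: list_induct2) (auto split: if_splits)
qed

lemma pattern_and_values_surj:
  assumes "length (filter (\<lambda>b. b) bs) = length vs" "0 \<notin> set vs"
  shows "\<exists>ns :: nat list. map (\<lambda>n. n \<noteq> 0) ns = bs \<and> filter (\<lambda>n. n \<noteq> 0) ns = vs"
  using assms
proof (induction bs arbitrary: vs)
  case (Cons b bs)
  show ?case
  proof (cases b)
    case True
    with Cons.prems obtain v ws where "vs = v # ws" by (cases vs) auto
    with True Cons obtain ns where "map (\<lambda>n. n \<noteq> 0) ns = bs" "filter (\<lambda>n. n \<noteq> 0) ns = ws"
      by fastforce
    then show ?thesis using True Cons.prems \<open>vs = v # ws\<close> by (intro exI[of _ "v # ns"]) auto
  next
    case False
    with Cons obtain ns where "map (\<lambda>n. n \<noteq> 0) ns = bs" "filter (\<lambda>n. n \<noteq> 0) ns = vs" by fastforce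
    then show ?thesis using False by (intro exI[of _ "0 # ns"]) auto
  qed
qed simp

text \<open>
  A list of natural numbers amounts to the pattern of its nonzero entries and the list of their
  values, which can be chosen independently.
\<close>

lemma bij_betw_pattern_and_values:
  "bij_betw (\<lambda>ns :: nat list. (map (\<lambda>n. n \<noteq> 0) ns, filter (\<lambda>n. n \<noteq> 0) ns))
     {ns. length ns = n \<and> length (filter (\<lambda>n. n \<noteq> 0) ns) = i \<and> sum_list ns = l}
     ({bs. length bs = n \<and> length (filter (\<lambda>b. b) bs) = i} \<times>
      {ms. length ms = i \<and> 0 \<notin> set ms \<and> sum_list ms = l})"
proof (rule bij_betw_imageI)
  let ?f = "\<lambda>ns :: nat list. (map (\<lambda>n. n \<noteq> 0) ns, filter (\<lambda>n. n \<noteq> 0) ns)"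
  let ?A = "{ns :: nat list. length ns = n \<and> length (filter (\<lambda>n. n \<noteq> 0) ns) = i \<and> sum_list ns = l}"
  let ?B = "{bs. length bs = n \<and> length (filter (\<lambda>b. b) bs) = i} \<times>
      {ms :: nat list. length ms = i \<and> 0 \<notin> set ms \<and> sum_list ms = l}"
  show "inj_on ?f ?A" by (rule inj_onI) (blast intro: pattern_and_values_inject)
  have sum: "sum_list (filter (\<lambda>n. n \<noteq> 0) ns) = sum_list ns" for ns :: "nat list"
    by (induction ns) auto
  have count: "length (filter (\<lambda>b. b) (map (\<lambda>n. n \<noteq> 0) ns)) = length (filter (\<lambda>n. n \<noteq> 0) ns)" for ns :: "nat list"
    by (induction ns) auto
  show "?f ` ?A = ?B"
  proof (intro equalityI subsetI)
    fix p assume "p \<in> ?B"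
    then obtain bs vs where p: "p = (bs, vs)" "length bs = n" "length (filter (\<lambda>b. b) bs) = i"
      "length vs = i" "0 \<notin> set vs" "sum_list vs = l" by auto
    then obtain ns where ns: "map (\<lambda>n. n \<noteq> 0) ns = bs" "filter (\<lambda>n. n \<noteq> 0) ns = vs"
      using pattern_and_values_surj[of bs vs] by auto
    have "length ns = n" using ns(1) p(2) by auto
    then have "ns \<in> ?A" using ns p sum[of ns] by auto
    then show "p \<in> ?f ` ?A" using ns p(1) by (intro image_eqI[of _ _ ns]) auto
  next
    fix p assume "p \<in> ?f ` ?A"
    then obtain ns where p: "p = ?f ns" and ns: "ns \<in> ?A" by (rule imageE)
    from ns have "map (\<lambda>n. n \<noteq> 0) ns \<in> {bs. length bs = n \<and> length (filter (\<lambda>b. b) bs) = i}"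
      unfolding mem_Collect_eq count by simp
    moreover from ns have "filter (\<lambda>n. n \<noteq> 0) ns \<in> {ms. length ms = i \<and> 0 \<notin> set ms \<and> sum_list ms = l}"
      unfolding mem_Collect_eq sum by simp
    ultimately show "p \<in> ?B" unfolding p by (rule SigmaI)
  qed
qed

text \<open>
  The separated lists are the lists \<open>spread 0 ns\<close>. If \<open>ns\<close> has
  \<open>i\<close> nonzero entries, then the spread list has length \<open>t\<close> exactly if
  \<open>ns\<close> has length \<open>t - i\<close>; this is the source of the binomial
  coefficient \<open>t - i\<close> over \<open>i\<close>, and the nonzero entries form a
  composition of \<open>l\<close>. The term \<open>i = 0\<close> is absent because
  \<open>l\<close> is positive.
\<close>

lemma card_abacus_lists:
  assumes "1 \<le> l"
  shows "finite {c. length c = t \<and> separated 0 c \<and> sum_list c = l}"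
    and "card {c. length c = t \<and> separated 0 c \<and> sum_list c = l}
      = (\<Sum>i = 1..t. ((t - i) choose i) * ((l - 1) choose (i - 1)))"
proof -
  let ?C = "{c :: nat list. length c = t \<and> separated 0 c \<and> sum_list c = l}"
  let ?N = "\<lambda>i. {ns :: nat list. length ns = t - i \<and> length (filter (\<lambda>n. n \<noteq> 0) ns) = i \<and> sum_list ns = l}"
  have C: "?C = spread 0 ` (\<Union>i\<in>{1..t}. ?N i)"
  proof (intro equalityI subsetI)
    fix c assume c: "c \<in> ?C"
    then obtain ns where ns: "c = spread 0 ns" using separated_imp_spread[of 0 c] by auto
    let ?i = "length (filter (\<lambda>n. n \<noteq> 0) ns)"
    have t: "length ns + ?i = t" using c ns length_spread[of 0 ns] by simp
    have "?i \<noteq> 0"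
    proof
      assume "?i = 0"
      then have "\<forall>n\<in>set ns. n = 0" by (simp add: filter_empty_conv)
      then have "sum_list ns = 0" by (simp only: sum_list_eq_0_iff)
      moreover have "sum_list ns = l" using c ns sum_list_spread_0[of ns] by simp
      ultimately show False using assms by linarith
    qed
    then have "1 \<le> ?i" by linarith
    then have "?i \<in> {1..t}" using t unfolding atLeastAtMost_iff by linarith
    moreover have "length ns = t - ?i" using t by linarith
    then have "ns \<in> ?N ?i" using c ns sum_list_spread_0[of ns] by simp
    ultimately show "c \<in> spread 0 ` (\<Union>i\<in>{1..t}. ?N i)" using ns by blast
  qed (auto simp: length_spread sum_list_spread_0 separated_spread)
  have fin: "finite (?N i)" for i
    by (rule finite_subset[OF _ finite_lists_length_eq[of "{..l}" "t - i"]])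
      (auto intro: member_le_sum_list)
  show "finite ?C" unfolding C using fin by blast
  have "card ?C = card (\<Union>i\<in>{1..t}. ?N i)"
    unfolding C by (rule card_image) (auto intro: inj_onI spread_inject)
  also have "\<dots> = (\<Sum>i = 1..t. card (?N i))"
    using fin by (intro card_UN_disjoint) auto
  also have "\<dots> = (\<Sum>i = 1..t. ((t - i) choose i) * ((l - 1) choose (i - 1)))"
  proof (rule sum.cong)
    fix i assume "i \<in> {1..t}"
    then show "card (?N i) = ((t - i) choose i) * ((l - 1) choose (i - 1))"
      using bij_betw_same_card[OF bij_betw_pattern_and_values[of "t - i" i l]]
        card_compositions[OF assms, of i]
      by (simp add: card_cartesian_product card_bool_lists)
  qed simp
  finally show "card ?C = (\<Sum>i = 1..t. ((t - i) choose i) * ((l - 1) choose (i - 1)))" .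
qed

lemma card_D':
  assumes "1 \<le> t" "1 \<le> l"
  shows "finite (D' t l)"
    and "card (D' t l) = (\<Sum>\<^sub>\<infinity>i\<in>{1..}. binom (int t - int i) i * binom (int l - 1) (i - 1))"
proof -
  note bij = bij_betw_D'_beads[OF assms(1), of l] bij_betw_abacus[OF assms(1), of l]
  show "finite (D' t l)"
    using card_abacus_lists(1)[OF assms(2), of t] bij_betw_finite[OF bij(1)] bij_betw_finite[OF bij(2)] by simp
  have "binom (int t - int i) i = (t - i) choose i" if "i \<le> t" for i
    using that by (auto simp: binom_def nat_diff_distrib)
  moreover have "binom (int l - 1) j = (l - 1) choose j" for j
    using assms(2) by (auto simp: binom_def nat_diff_distrib)
  ultimately show "card (D' t l) = (\<Sum>\<^sub>\<infinity>i\<in>{1..}. binom (int t - int i) i * binom (int l - 1) (i - 1))"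
    unfolding binom_infsum_eq_sum
    using card_abacus_lists(2)[OF assms(2), of t] bij_betw_same_card[OF bij(1)] bij_betw_same_card[OF bij(2)]
    by simp
qed

section \<open>Cores as words of blocks\<close>

text \<open>
  A sparse set is encoded by its indicator word up to the largest element. The word is a
  concatenation of blocks \<open>False\<close> and \<open>False, True\<close>, and the list of
  blocks is a list of Booleans ending in \<open>True\<close>.
\<close>

abbreviation word :: "bool list \<Rightarrow> bool list" where
  "word \<equiv> spread False"

definition core_word :: "nat \<Rightarrow> bool list \<Rightarrow> bool" where
  "core_word t w \<longleftrightarrow> (\<forall>i. i + t < length w \<longrightarrow> w ! (i + t) \<longrightarrow> w ! i)"

definition support :: "bool list \<Rightarrow> nat set" where
  "support w = {i. i < length w \<and> w ! i}"

lemma closed_down_support: "closed_down t (support w) \<longleftrightarrow> core_word t w"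
  by (auto simp: closed_down_def support_def core_word_def)

lemma finite_support: "finite (support w)"
  by (simp add: support_def)

lemma card_support: "card (support w) = length (filter (\<lambda>b. b) w)"
  by (simp add: support_def length_filter_conv_card)

lemma Max_support:
  assumes "w \<noteq> []" "last w" shows "Suc (Max (support w)) = length w"
proof -
  have "Max (support w) = length w - 1"
    using assms by (intro Max_eqI) (auto simp: finite_support, auto simp: support_def last_conv_nth)
  then show ?thesis using assms(1) by simp
qed

lemma last_word: "bs \<noteq> [] \<Longrightarrow> last bs \<Longrightarrow> last (word bs)"
  by (cases bs rule: rev_cases) auto

text \<open>
  Every block contains exactly one \<open>False\<close>, so the gaps are counted by the blocks.
  For the bead set of a partition this is the largest part.
\<close>

lemma support_word_gaps:
  assumes "bs \<noteq> []" "last bs"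
  shows "Suc (Max (support (word bs))) - card (support (word bs)) = length bs"
proof -
  have "filter (\<lambda>b. b) (word bs) = filter (\<lambda>b. b) bs" using filter_spread[of False bs] by simp
  moreover have "length (word bs) = length bs + length (filter (\<lambda>b. b) bs)"
    using length_spread[of False bs] by simp
  moreover have "Suc (Max (support (word bs))) = length (word bs)"
    using assms by (intro Max_support) (simp_all add: last_word)
  ultimately show ?thesis by (simp add: card_support)
qed

lemma not_word_0: "bs \<noteq> [] \<Longrightarrow> \<not> word bs ! 0"
  by (cases bs) auto

lemma bij_betw_support_word:
  "bij_betw (\<lambda>bs. support (word bs)) {bs. bs \<noteq> [] \<and> last bs} {X. sparse X \<and> X \<noteq> {}}"
proof (rule bij_betw_imageI)
  show "inj_on (\<lambda>bs. support (word bs)) {bs. bs \<noteq> [] \<and> last bs}"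
  proof (rule inj_onI)
    fix as bs
    assume as: "as \<in> {bs. bs \<noteq> [] \<and> last bs}" and bs: "bs \<in> {bs. bs \<noteq> [] \<and> last bs}"
      and eq: "support (word as) = support (word bs)"
    have "length (word as) = Suc (Max (support (word as)))"
      by (rule Max_support[symmetric]) (use as last_word[of as] in auto)
    also have "\<dots> = length (word bs)"
      unfolding eq by (rule Max_support) (use bs last_word[of bs] in auto)
    finally have len: "length (word as) = length (word bs)" .
    have "word as ! i = word bs ! i" if "i < length (word as)" for i
    proof -
      have "word as ! i \<longleftrightarrow> i \<in> support (word as)" using that by (simp add: support_def)
      also have "\<dots> \<longleftrightarrow> word bs ! i" unfolding eq using that len by (simp add: support_def)
      finally show ?thesis .
    qed
    with len have "word as = word bs" by (rule nth_equalityI)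
    then show "as = bs" by (rule spread_inject)
  qed
  show "(\<lambda>bs. support (word bs)) ` {bs. bs \<noteq> [] \<and> last bs} = {X. sparse X \<and> X \<noteq> {}}"
  proof (intro equalityI subsetI)
    fix X :: "nat set" assume "X \<in> {X. sparse X \<and> X \<noteq> {}}"
    then have X: "sparse X" "X \<noteq> {}" "finite X" by (simp_all add: sparse_def)
    define w where "w = map (\<lambda>i. i \<in> X) [0..<Suc (Max X)]"
    have len: "length w = Suc (Max X)" by (simp add: w_def)
    have nth: "w ! i \<longleftrightarrow> i \<in> X" if "i < length w" for i
      using that unfolding len by (simp add: w_def del: upt_Suc)
    have supp: "support w = X"
      using Max_ge[OF X(3)] by (auto simp: support_def nth len less_Suc_eq_le)
    have ne: "w \<noteq> []" using len by auto
    have "\<not> w ! 0" using nth[of 0] X(1) len by (simp add: sparse_def)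
    moreover have "\<not> w ! i \<or> \<not> w ! Suc i" if "Suc i < length w" for i
      using nth[of i] nth[of "Suc i"] that X(1) by (auto simp: sparse_def)
    ultimately have "separated False w" by (simp add: separated_nth)
    then obtain bs where bs: "w = word bs" using separated_imp_spread[of False w] by auto
    have "last w" using nth[of "Max X"] Max_in[OF X(3,2)] ne len by (simp add: last_conv_nth)
    then have "bs \<noteq> [] \<and> last bs"
      using ne unfolding bs by (cases bs rule: rev_cases) (auto split: if_splits)
    then show "X \<in> (\<lambda>bs. support (word bs)) ` {bs. bs \<noteq> [] \<and> last bs}"
      using supp bs by (intro image_eqI[of _ _ bs]) simp_all
  next
    fix X assume "X \<in> (\<lambda>bs. support (word bs)) ` {bs. bs \<noteq> [] \<and> last bs}"
    then obtain bs where bs: "X = support (word bs)" "bs \<noteq> []" "last bs" by auto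
    have sep: "separated False (word bs)" by (rule separated_spread)
    have "0 \<notin> X" using not_word_0[OF bs(2)] by (simp add: bs(1) support_def)
    moreover have "Suc i \<notin> X" if "i \<in> X" for i
      using sep that unfolding bs(1) support_def separated_nth by auto
    moreover have "X \<noteq> {}"
      using last_word[OF bs(2,3)] bs(2)
      unfolding bs(1) support_def by (auto simp: last_conv_nth intro!: exI[of _ "length (word bs) - 1"])
    ultimately show "X \<in> {X. sparse X \<and> X \<noteq> {}}"
      by (simp add: sparse_def bs(1) finite_support)
  qed
qed

definition blocks :: "nat \<Rightarrow> nat \<Rightarrow> bool list set" where
  "blocks t x = {bs. length bs = x \<and> last bs \<and> core_word t (word bs)}"

text \<open>
  Partitions and block lists are matched through their common bead sets. The empty partition has
  the empty bead set, which is the support of no word ending in \<open>True\<close>; its largest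
  part is \<open>0\<close>, so it is excluded on both sides.
\<close>

lemma card_D_eq_card_blocks:
  assumes "1 \<le> t" "1 \<le> x"
  shows "card (D t x) = card (blocks t x)"
proof -
  let ?Q = "\<lambda>X. closed_down t X \<and> X \<noteq> {} \<and> Suc (Max X) - card X = x"
  have "bij_betw (\<lambda>ps. beads (set ps))
      {ps. (is_partition ps \<and> distinct ps) \<and> t_core t ps \<and> largest_part ps = x}
      {X. sparse X \<and> ?Q X}"
  proof (rule bij_betw_Collect_cong[OF bij_betw_beads,
        where P' = "\<lambda>ps. t_core t ps \<and> largest_part ps = x" and Q' = ?Q])
    fix ps assume ps: "is_partition ps \<and> distinct ps"
    show "(t_core t ps \<and> largest_part ps = x) \<longleftrightarrow> ?Q (beads (set ps))"
    proof (cases "ps = []")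
      case True
      then show ?thesis using assms(2) by (simp add: beads_def largest_part_def)
    next
      case False
      then have "beads (set ps) \<noteq> {}" by (simp add: beads_def)
      moreover have "card (beads (set ps)) = length ps" using ps by (simp add: card_beads distinct_card)
      ultimately show ?thesis
        using ps False t_core_iff_closed_down[OF _ _ assms(1), of ps] largest_part_eq[of ps] by simp
    qed
  qed
  then have "card (D t x) = card {X. sparse X \<and> ?Q X}"
    unfolding D_def by (simp only: conj_assoc bij_betw_same_card)
  moreover have "bij_betw (\<lambda>bs. support (word bs))
      {bs. (bs \<noteq> [] \<and> last bs) \<and> core_word t (word bs) \<and> length bs = x}
      {X. (sparse X \<and> X \<noteq> {}) \<and> closed_down t X \<and> Suc (Max X) - card X = x}"
  proof (rule bij_betw_Collect_cong[OF bij_betw_support_word,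
        where P' = "\<lambda>bs. core_word t (word bs) \<and> length bs = x"
          and Q' = "\<lambda>X. closed_down t X \<and> Suc (Max X) - card X = x"])
    fix bs assume "bs \<noteq> [] \<and> last bs"
    then show "(core_word t (word bs) \<and> length bs = x) \<longleftrightarrow>
        (closed_down t (support (word bs)) \<and> Suc (Max (support (word bs))) - card (support (word bs)) = x)"
      using support_word_gaps[of bs] by (simp add: closed_down_support)
  qed
  then have "card {bs. (bs \<noteq> [] \<and> last bs) \<and> core_word t (word bs) \<and> length bs = x}
      = card {X. (sparse X \<and> X \<noteq> {}) \<and> closed_down t X \<and> Suc (Max X) - card X = x}"
    by (rule bij_betw_same_card)
  moreover have "{bs. (bs \<noteq> [] \<and> last bs) \<and> core_word t (word bs) \<and> length bs = x} = blocks t x"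
    using assms(2) by (auto simp: blocks_def)
  moreover have "{X. (sparse X \<and> X \<noteq> {}) \<and> closed_down t X \<and> Suc (Max X) - card X = x}
      = {X. sparse X \<and> ?Q X}" by blast
  ultimately show ?thesis by simp
qed

lemma length_word_le: "length (word bs) \<le> 2 * length bs"
  using length_filter_le[of "\<lambda>b. b" bs] length_spread[of False bs] by simp

lemma core_word_short: "length w \<le> t \<Longrightarrow> core_word t w"
  by (simp add: core_word_def)

lemma core_word_iterate:
  "core_word t w \<Longrightarrow> i + k * t < length w \<Longrightarrow> w ! (i + k * t) \<Longrightarrow> w ! i"
proof (induction k)
  case (Suc k)
  have "i + k * t + t = i + Suc k * t" by simp
  then have "w ! (i + k * t)" using Suc.prems unfolding core_word_def by metis
  then show ?case using Suc by simp
qed simp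

text \<open>
  If the modulus is the length of \<open>Q @ R\<close>, then position \<open>i\<close> of
  \<open>P\<close> is compared with the position of the same index in the suffix of length
  \<open>length P\<close>. As long as this suffix lies within \<open>R\<close>, the comparison
  does not involve \<open>Q\<close>.
\<close>

lemma core_word_remove_middle:
  assumes "length P \<le> length R"
  shows "core_word (length (Q @ R)) (P @ Q @ R) \<longleftrightarrow> core_word (length R) (P @ R)"
proof -
  have "core_word (length (Q @ R)) (P @ Q @ R) \<longleftrightarrow>
      (\<forall>i<length P. R ! (i + length R - length P) \<longrightarrow> P ! i)" for Q
  proof -
    have "(P @ Q @ R) ! (i + length (Q @ R)) = R ! (i + length R - length P)" for i
    proof -
      have "i + length (Q @ R) = length P + (length Q + (i + length R - length P))"
        using assms by simp
      then show ?thesis by (simp only: nth_append_length_plus)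
    qed
    moreover have "(P @ Q @ R) ! i = P ! i" if "i < length P" for i
      using that by (simp add: nth_append)
    ultimately show ?thesis by (auto simp: core_word_def)
  qed
  from this[of Q] this[of "[]"] show ?thesis by simp
qed

lemma all_blocks_True:
  assumes "length (word bs) = 2 * length bs"
  shows "bs = replicate (length bs) True"
proof -
  have "length (filter (\<lambda>b. b) bs) = length bs" using assms length_spread[of False bs] by simp
  then have "\<forall>b\<in>set bs. b" using length_filter_less[of _ bs "\<lambda>b. b"] by (metis less_irrefl)
  then show ?thesis by (intro replicate_length_same[symmetric]) simp
qed

lemma length_word_replicate: "length (word (replicate n True)) = 2 * n"
  by (induction n) auto

lemma nth_word_replicate: "i < 2 * n \<Longrightarrow> word (replicate n True) ! i \<longleftrightarrow> odd i"
proof (induction n arbitrary: i)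
  case (Suc n)
  then show ?case
    by (cases i; cases "i - 1") auto
qed simp

text \<open>
  These are the words of the staircase partitions. Their \<open>True\<close> entries are the odd
  positions, which an even step preserves.
\<close>

lemma core_word_staircase: "even t \<Longrightarrow> core_word t (word (replicate n True))"
  by (auto simp: core_word_def length_word_replicate nth_word_replicate)

text \<open>
  This is the heart of the recurrence. Cut the word of length \<open>L\<close> at \<open>s = L -
  t\<close>, or at \<open>0\<close> if \<open>L \<le> t\<close>. Removing the block that starts at
  the cut lowers the length and the modulus by the same amount and so leaves the cut in place. The
  core condition compares the prefix and the suffix of length \<open>s\<close>, neither of which
  meets the removed block if that block ends at or before position \<open>t\<close>. Because there
  are at most \<open>t\<close> blocks, \<open>L \<le> 2 * t\<close>, and the block can reach
  beyond \<open>t\<close> only if \<open>b\<close> holds and \<open>L\<close> is \<open>2 *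
  t\<close> or \<open>2 * t - 1\<close>. In the first case both words are staircases with even
  modulus, hence cores. In the second case a chain of steps leads from a \<open>True\<close> to
  position \<open>0\<close> in either word, so neither is a core.
\<close>

lemma core_word_remove_block:
  assumes t: "3 \<le> t" and x: "length (us @ b # vs) \<le> t" and vs: "vs \<noteq> []" "last vs"
    and cut: "length (word us) = length (word (us @ b # vs)) - t"
  shows "core_word t (word (us @ b # vs)) \<longleftrightarrow>
         core_word (t - length (word [b])) (word (us @ vs))"
proof -
  define P Q R where "P = word us" and "Q = word [b]" and "R = word vs"
  have w: "word (us @ b # vs) = P @ Q @ R" "word (us @ vs) = P @ R"
    by (simp_all add: P_def Q_def R_def)
  have lenQ: "length Q = (if b then 2 else 1)" by (simp add: Q_def)
  have cut': "length P = length P + length Q + length R - t"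
    using cut unfolding w by (simp add: P_def[symmetric])
  have "R \<noteq> []" "last R" using vs last_word by (simp_all add: R_def)
  show ?thesis
  proof (cases "length P = 0")
    case True
    then have "length (P @ Q @ R) \<le> t" "length (P @ R) \<le> t - length Q" using cut' by auto
    then show ?thesis unfolding w Q_def[symmetric] by (simp add: core_word_short del: length_append)
  next
    case False
    then have QR: "length Q + length R = t" using cut' by linarith
    show ?thesis
    proof (cases "length P \<le> length R")
      case True
      have "length (Q @ R) = t" "t - length Q = length R" using QR by simp_all
      then show ?thesis
        using core_word_remove_middle[OF True, of Q] unfolding w Q_def[symmetric] by simp
    next
      case PR: False
      have "length P + t = length (word (us @ b # vs))" unfolding w using QR by simp
      also have "\<dots> \<le> 2 * length (us @ b # vs)" by (rule length_word_le)
      also have "\<dots> \<le> 2 * t" using x by simp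
      finally have "length P \<le> t" by simp
      have full: "us @ b # vs = replicate (length (us @ b # vs)) True" "length (us @ b # vs) = t"
        if "length P = t"
      proof -
        have L: "length (word (us @ b # vs)) = 2 * t" unfolding w using QR that by simp
        then show l: "length (us @ b # vs) = t" using length_word_le[of "us @ b # vs"] x by simp
        show "us @ b # vs = replicate (length (us @ b # vs)) True"
          by (rule all_blocks_True) (simp only: L l)
      qed
      have b: b
      proof (rule ccontr)
        assume "\<not> b"
        then have "length P = t" using lenQ QR PR \<open>length P \<le> t\<close> by simp
        then have "\<forall>c\<in>set (us @ b # vs). c" using full by (metis in_set_replicate)
        with \<open>\<not> b\<close> show False by simp
      qed
      with lenQ QR have lenR: "length R = t - 2" and lenQ2: "length Q = 2" by simp_all
      consider "length P = t" | "length P = t - 1" using PR lenR \<open>length P \<le> t\<close> by linarith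
      then show ?thesis
      proof cases
        case 1
        have all: "\<forall>c\<in>set (us @ b # vs). c" using full[OF 1] by (metis in_set_replicate)
        have us: "replicate (length us) True = us" using all by (intro replicate_length_same) auto
        have us_vs: "us @ vs = replicate (length (us @ vs)) True"
          using all by (intro replicate_length_same[symmetric]) auto
        have "even t"
          using 1 length_word_replicate[of "length us"] unfolding P_def us by (metis dvd_triv_left)
        have "core_word t (word (us @ b # vs))"
          by (subst full(1)[OF 1], rule core_word_staircase) fact
        moreover have "core_word (t - 2) (word (us @ vs))"
          by (subst us_vs, rule core_word_staircase) (simp add: \<open>even t\<close>)
        ultimately show ?thesis using lenQ2 unfolding Q_def by simp
      next
        case 2
        have "us \<noteq> []" using False by (auto simp: P_def)
        then have P0: "\<not> P ! 0" using not_word_0 by (simp add: P_def)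
        \<comment> \<open>Position t is the second position of the removed block, a True that sits t above position 0.\<close>
        have "\<not> core_word t (P @ Q @ R)"
        proof
          assume "core_word t (P @ Q @ R)"
          moreover have "(P @ Q @ R) ! (0 + t)"
          proof -
            have "0 + t = length P + 1" using 2 t by simp
            then have "(P @ Q @ R) ! (0 + t) = (Q @ R) ! 1" by (simp only: nth_append_length_plus)
            then show ?thesis using b by (simp add: Q_def)
          qed
          moreover have "0 + t < length (P @ Q @ R)" using 2 t lenQ2 by simp
          ultimately have "(P @ Q @ R) ! 0" unfolding core_word_def by blast
          then show False using P0 False by (simp add: nth_append)
        qed
        moreover have "\<not> core_word (t - 2) (P @ R)"
        proof
          assume core: "core_word (t - 2) (P @ R)"
          \<comment> \<open>The shortened word has length 2 * t - 3, so its final True lies two steps of size t - 2 above position 0.\<close>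
          have idx: "0 + 2 * (t - 2) = length (P @ R) - 1" using 2 lenR t by simp
          have "last (P @ R)" using \<open>R \<noteq> []\<close> \<open>last R\<close> by simp
          then have "(P @ R) ! (0 + 2 * (t - 2))"
            unfolding idx using \<open>R \<noteq> []\<close> by (subst (asm) last_conv_nth) simp_all
          moreover have "0 + 2 * (t - 2) < length (P @ R)" using 2 lenR t by simp
          ultimately have "(P @ R) ! 0" using core_word_iterate[OF core] by blast
          then show False using P0 False by (simp add: nth_append)
        qed
        ultimately show ?thesis unfolding w using lenQ2 by (simp add: Q_def)
      qed
    qed
  qed
qed

text \<open>
  A position is a block boundary if it is preceded by a \<open>True\<close>, since a
  \<open>True\<close> always ends its block.
\<close>

lemma split_at_block_boundary:
  "n < length (word bs) \<Longrightarrow> n = 0 \<or> word bs ! (n - 1) \<Longrightarrow> \<exists>us vs. bs = us @ vs \<and> length (word us) = n"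
proof (induction bs arbitrary: n)
  case (Cons b bs)
  show ?case
  proof (cases "n = 0")
    case True
    then have "b # bs = [] @ (b # bs) \<and> length (word []) = n" by simp
    then show ?thesis by blast
  next
    case False
    let ?k = "length (word [b])"
    obtain m where m: "n = Suc m" using False by (cases n) auto
    have n: "?k \<le> n" "n = ?k \<or> word bs ! (n - ?k - 1)"
      using Cons.prems m by (cases m; cases "m - 1"; auto split: if_splits)+
    show ?thesis
    proof (cases "n = ?k")
      case True
      then have "b # bs = [b] @ bs \<and> length (word [b]) = n" by simp
      then show ?thesis by blast
    next
      case neq: False
      have "n - ?k < length (word bs)" using Cons.prems(1) n(1) by (auto split: if_splits)
      then obtain us vs where "bs = us @ vs" "length (word us) = n - ?k"
        using Cons.IH[of "n - ?k"] n neq by blast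
      then have "b # bs = (b # us) @ vs \<and> length (word (b # us)) = n" using n(1) by auto
      then show ?thesis by blast
    qed
  qed
qed simp

lemma prefix_length_word_inject:
  assumes "us @ vs = us' @ vs'" "length (word us) = length (word us')"
  shows "us = us'"
proof -
  obtain zs where "us = us' @ zs \<or> us' = us @ zs"
    using assms(1) by (auto simp: append_eq_append_conv2)
  then show ?thesis using assms(2) by auto
qed

section \<open>Removing the block at the cut\<close>

text \<open>
  Block lists with the cut made explicit. The truncated subtraction puts the cut at the start of
  words of length at most \<open>t\<close>.
\<close>

definition cuts :: "nat \<Rightarrow> nat \<Rightarrow> (bool list \<times> bool list) set" where
  "cuts t x = {(us, vs). us @ vs \<in> blocks t x \<and> length (word us) = length (word (us @ vs)) - t}"

text \<open>
  Every core word can be cut: if it is longer than \<open>t\<close>, the final \<open>True\<close>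
  forces a \<open>True\<close> at distance \<open>t\<close> below it, which is the last position
  before the cut, so the cut falls on a block boundary.
\<close>

lemma card_cuts:
  assumes "1 \<le> t" "1 \<le> x"
  shows "card (cuts t x) = card (blocks t x)"
proof -
  have "bij_betw (\<lambda>(us, vs). us @ vs) (cuts t x) (blocks t x)"
  proof (rule bij_betw_imageI)
    show "inj_on (\<lambda>(us, vs). us @ vs) (cuts t x)"
    proof (rule inj_onI, clarify)
      fix us vs us' vs' assume "(us, vs) \<in> cuts t x" "(us', vs') \<in> cuts t x" and eq: "us @ vs = us' @ vs'"
      then have "length (word us) = length (word (us @ vs)) - t"
        "length (word us') = length (word (us' @ vs')) - t"
        by (simp_all only: cuts_def mem_Collect_eq prod.case)
      with eq have "length (word us) = length (word us')" by (simp only:)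
      with eq have "us = us'" by (rule prefix_length_word_inject)
      then show "us = us' \<and> vs = vs'" using eq by simp
    qed
    show "(\<lambda>(us, vs). us @ vs) ` cuts t x = blocks t x"
    proof (intro equalityI subsetI)
      fix bs assume bs: "bs \<in> blocks t x"
      let ?L = "length (word bs)" and ?n = "length (word bs) - t"
      have ne: "bs \<noteq> []" and "last bs" and core: "core_word t (word bs)"
        using bs assms(2) by (auto simp: blocks_def)
      have "word bs \<noteq> []" using ne by simp
      then have "?n < ?L" using assms(1) by (simp add: diff_less)
      moreover have "?n = 0 \<or> word bs ! (?n - 1)"
      proof (cases "?n = 0")
        case False
        then have eq: "?n - 1 + t = ?L - 1" by simp
        have "word bs ! (?L - 1)"
          using last_word[OF ne \<open>last bs\<close>] last_conv_nth[OF \<open>word bs \<noteq> []\<close>] by simp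
        then have "word bs ! (?n - 1 + t)" unfolding eq .
        moreover have "?n - 1 + t < ?L" using False by simp
        ultimately show ?thesis using core unfolding core_word_def by blast
      qed simp
      ultimately obtain us vs where "bs = us @ vs" "length (word us) = ?n"
        using split_at_block_boundary[of ?n bs] by blast
      then have "(us, vs) \<in> cuts t x" using bs by (simp add: cuts_def)
      then show "bs \<in> (\<lambda>(us, vs). us @ vs) ` cuts t x"
        using \<open>bs = us @ vs\<close> by (intro image_eqI[of _ _ "(us, vs)"]) simp_all
    qed (auto simp: cuts_def)
  qed
  then show ?thesis by (rule bij_betw_same_card)
qed

lemma finite_blocks: "finite (blocks t x)"
  by (rule finite_subset[OF _ finite_lists_length_eq[of "UNIV :: bool set" x]]) (auto simp: blocks_def)

lemma finite_cuts: "finite (cuts t x)"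
proof (rule finite_subset)
  show "cuts t x \<subseteq> (\<Union>bs\<in>blocks t x. (\<lambda>k. (take k bs, drop k bs)) ` {..x})"
  proof
    fix p assume "p \<in> cuts t x"
    then obtain us vs where "p = (us, vs)" "us @ vs \<in> blocks t x" by (auto simp: cuts_def)
    then show "p \<in> (\<Union>bs\<in>blocks t x. (\<lambda>k. (take k bs, drop k bs)) ` {..x})"
      by (intro UN_I[of "us @ vs"] image_eqI[of _ _ "length us"]) (auto simp: blocks_def)
  qed
qed (simp add: finite_blocks)

text \<open>
  Besides \<open>core_word_remove_block\<close>, this uses that the removed block is never the
  last one: if nothing followed it, the cut would lie at the start and the list would consist of a
  single block.
\<close>

lemma cuts_Cons_iff:
  assumes "3 \<le> t" "2 \<le> x" "x \<le> t"
  shows "(us, b # vs) \<in> cuts t x \<longleftrightarrow> (us, vs) \<in> cuts (t - length (word [b])) (x - 1)"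
proof -
  let ?k = "length (word [b])"
  have k: "?k < t" using assms(1) by simp
  have len: "length (word (us @ b # vs)) = length (word us) + ?k + length (word vs)"
    "length (word (us @ vs)) = length (word us) + length (word vs)" by simp_all
  have cut: "length (word us) = length (word (us @ b # vs)) - t \<longleftrightarrow>
      length (word us) = length (word (us @ vs)) - (t - ?k)"
    unfolding len using k by linarith
  show ?thesis
  proof (cases "vs = []")
    case True
    have "length (word us) = length (word us) - (t - ?k) \<longrightarrow> us = []"
    proof
      assume "length (word us) = length (word us) - (t - ?k)"
      then have "length (word us) = 0" using k by linarith
      then show "us = []" by simp
    qed
    moreover have "us \<noteq> []" if "(us, b # vs) \<in> cuts t x \<or> (us, vs) \<in> cuts (t - ?k) (x - 1)"
      using that True assms(2) unfolding cuts_def blocks_def by auto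
    moreover have "length (word us) = length (word us) - (t - ?k)"
      if "(us, b # vs) \<in> cuts t x \<or> (us, vs) \<in> cuts (t - ?k) (x - 1)"
    proof -
      have "length (word us) = length (word (us @ vs)) - (t - ?k)"
        using that cut unfolding cuts_def by blast
      then show ?thesis unfolding True append_Nil2 .
    qed
    ultimately show ?thesis by blast
  next
    case False
    then show ?thesis
      using core_word_remove_block[OF assms(1) _ False, of us b] cut assms
      unfolding cuts_def blocks_def by auto
  qed
qed

lemma cuts_Nil: "3 \<le> t \<Longrightarrow> 1 \<le> x \<Longrightarrow> (us, []) \<notin> cuts t x"
proof
  assume "3 \<le> t" "1 \<le> x" "(us, []) \<in> cuts t x"
  then have "length (word us) = length (word us) - t" "us \<noteq> []" "3 \<le> t"
    by (auto simp: cuts_def blocks_def)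
  moreover have "length (word us) \<noteq> 0" using \<open>us \<noteq> []\<close> by simp
  ultimately show False by linarith
qed

text \<open>
  The summands count the lists whose block at the cut is \<open>False\<close> and \<open>False,
  True\<close> respectively.
\<close>

lemma card_blocks_recurrence:
  assumes "3 \<le> t" "2 \<le> x" "x \<le> t"
  shows "card (blocks t x) = card (blocks (t - 1) (x - 1)) + card (blocks (t - 2) (x - 1))"
proof -
  let ?ins = "\<lambda>b (us, vs). (us, b # vs)"
  have "cuts t x = ?ins False ` cuts (t - 1) (x - 1) \<union> ?ins True ` cuts (t - 2) (x - 1)"
  proof (intro equalityI subsetI)
    fix p assume p: "p \<in> cuts t x"
    obtain us ws where "p = (us, ws)" by (cases p)
    moreover from this p have "ws \<noteq> []" using cuts_Nil[of t x us] assms by auto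
    ultimately obtain b vs where p_eq: "p = (us, b # vs)" by (cases ws) auto
    show "p \<in> ?ins False ` cuts (t - 1) (x - 1) \<union> ?ins True ` cuts (t - 2) (x - 1)"
    proof (cases b)
      case True
      then have "(us, vs) \<in> cuts (t - 2) (x - 1)"
        using p cuts_Cons_iff[OF assms, of us b vs] by (simp add: p_eq numeral_2_eq_2)
      then show ?thesis using True by (intro UnI2 image_eqI[of _ _ "(us, vs)"]) (simp_all add: p_eq)
    next
      case False
      then have "(us, vs) \<in> cuts (t - 1) (x - 1)"
        using p cuts_Cons_iff[OF assms, of us b vs] by (simp add: p_eq)
      then show ?thesis using False by (intro UnI1 image_eqI[of _ _ "(us, vs)"]) (simp_all add: p_eq)
    qed
  next
    fix p assume "p \<in> ?ins False ` cuts (t - 1) (x - 1) \<union> ?ins True ` cuts (t - 2) (x - 1)"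
    then show "p \<in> cuts t x"
      using cuts_Cons_iff[OF assms, of _ False] cuts_Cons_iff[OF assms, of _ True] by (auto simp: numeral_2_eq_2)
  qed
  moreover have "?ins False ` cuts (t - 1) (x - 1) \<inter> ?ins True ` cuts (t - 2) (x - 1) = {}" by auto
  moreover have "card (?ins b ` A) = card A" for b :: bool and A :: "(bool list \<times> bool list) set"
    by (rule card_image) (auto simp: inj_on_def)
  ultimately have "card (cuts t x) = card (cuts (t - 1) (x - 1)) + card (cuts (t - 2) (x - 1))"
    by (simp add: card_Un_disjoint finite_cuts)
  then show ?thesis using assms by (simp add: card_cuts)
qed

section \<open>Boundary values\<close>

lemma blocks_1: "1 \<le> x \<Longrightarrow> blocks 1 x = {}"
proof -
  assume x: "1 \<le> x"
  have False if "bs \<in> blocks 1 x" for bs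
  proof -
    have bs: "bs \<noteq> []" "last bs" "core_word 1 (word bs)" using that x by (auto simp: blocks_def)
    let ?L = "length (word bs)"
    have "word bs ! (0 + (?L - 1) * 1)"
      using last_word[OF bs(1,2)] bs(1) by (simp add: last_conv_nth)
    moreover have "0 + (?L - 1) * 1 < ?L" using bs(1) by simp
    ultimately have "word bs ! 0" using core_word_iterate[OF bs(3)] by blast
    then show False using not_word_0[OF bs(1)] by simp
  qed
  then show ?thesis by blast
qed

text \<open>
  The positions at even distance below the final \<open>True\<close> are all \<open>True\<close>.
  A block \<open>False\<close> that is followed by another block would give two adjacent positions
  that are \<open>False\<close>, one of which has the forbidden parity.
\<close>

lemma blocks_2: "1 \<le> x \<Longrightarrow> blocks 2 x = {replicate x True}"
proof (intro equalityI subsetI)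
  assume x: "1 \<le> x"
  fix bs assume mem: "bs \<in> blocks 2 x"
  then have bs: "bs \<noteq> []" "last bs" "core_word 2 (word bs)" "length bs = x" using x by (auto simp: blocks_def)
  have "False \<notin> set bs"
  proof
    assume "False \<in> set bs"
    then obtain us vs where split: "bs = us @ False # vs" by (meson split_list)
    then have vs: "vs \<noteq> []" using bs(2) by auto
    let ?L = "length (word bs)" and ?n = "length (word us)"
    have L: "?n + 1 < ?L" using vs by (simp add: split)
    have zero: "\<not> word bs ! ?n" "\<not> word bs ! (?n + 1)"
      using not_word_0[OF vs] by (simp_all add: split nth_append)
    have last: "word bs ! (?L - 1)"
      using last_word[OF bs(1,2)] bs(1) by (simp add: last_conv_nth)
    have parity: "\<exists>k. b - 1 = a + k * 2 \<or> b - 1 = a + 1 + k * 2" if "a + 1 < b" for a b :: nat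
      using that by presburger
    obtain k where "?L - 1 = ?n + k * 2 \<or> ?L - 1 = ?n + 1 + k * 2"
      using parity[OF L] by (elim exE)
    then show False
    proof
      assume *: "?L - 1 = ?n + k * 2"
      have "?n + k * 2 < ?L" using * L by linarith
      with core_word_iterate[OF bs(3) this] last zero(1) * show False by simp
    next
      assume *: "?L - 1 = ?n + 1 + k * 2"
      have "?n + 1 + k * 2 < ?L" using * L by linarith
      with core_word_iterate[OF bs(3) this] last zero(2) * show False by simp
    qed
  qed
  then have "bs = replicate x True" using bs(4) by (intro nth_equalityI) (auto simp: in_set_conv_nth)
  then show "bs \<in> {replicate x True}" by simp
qed (auto simp: blocks_def core_word_staircase)

text \<open>
  A word of \<open>x\<close> blocks has length at most \<open>2 * x \<le> t\<close>, so the core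
  condition is empty, and every block but the last can be chosen freely.
\<close>

lemma card_blocks_large_modulus:
  assumes "1 \<le> x" "2 * x \<le> t" shows "card (blocks t x) = 2 ^ (x - 1)"
proof -
  have "blocks t x = (\<lambda>us. us @ [True]) ` {us. set us \<subseteq> UNIV \<and> length us = x - 1}"
  proof (intro equalityI subsetI)
    fix bs assume "bs \<in> blocks t x"
    then show "bs \<in> (\<lambda>us. us @ [True]) ` {us. set us \<subseteq> UNIV \<and> length us = x - 1}"
      using assms(1) by (cases bs rule: rev_cases) (auto simp: blocks_def)
  next
    fix bs assume "bs \<in> (\<lambda>us. us @ [True]) ` {us :: bool list. set us \<subseteq> UNIV \<and> length us = x - 1}"
    then have "length bs = x" "last bs" using assms(1) by auto
    moreover from this have "core_word t (word bs)"
      using length_word_le[of bs] assms(2) by (intro core_word_short) linarith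
    ultimately show "bs \<in> blocks t x" by (simp add: blocks_def)
  qed
  then have "card (blocks t x) = card {us :: bool list. set us \<subseteq> UNIV \<and> length us = x - 1}"
    by (simp add: card_image inj_on_def)
  then show ?thesis using card_lists_length_eq[of "UNIV :: bool set" "x - 1"] by (simp add: card_UNIV_bool)
qed

theorem theorem4p4:
  shows "(\<forall>t l :: nat. 1 \<le> t \<and> 1 \<le> l \<longrightarrow>
           finite (D' t l) \<and>
           card (D' t l) = (\<Sum>\<^sub>\<infinity>i\<in>{1..}. binom (int t - int i) i * binom (int l - 1) (i - 1)))
       \<and> (\<forall>t x :: nat. 3 \<le> t \<and> 2 \<le> x \<and> x \<le> t \<longrightarrow>
           card (D t x) = card (D (t - 1) (x - 1)) + card (D (t - 2) (x - 1)))
       \<and> (\<forall>t :: nat. 1 \<le> t \<longrightarrow> card (D t 0) = 1)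
       \<and> (\<forall>t :: nat. 2 \<le> t \<longrightarrow> card (D t 1) = 1)
       \<and> (\<forall>x :: nat. 1 \<le> x \<longrightarrow> card (D 1 x) = 0)
       \<and> (\<forall>x :: nat. 1 \<le> x \<longrightarrow> card (D 2 x) = 1)
       \<and> (\<forall>t x :: nat. 1 \<le> t \<and> 1 \<le> x \<and> real x \<le> real t / 2 \<longrightarrow> card (D t x) = 2 ^ (x - 1))"
proof (intro conjI allI impI)
  fix t x :: nat assume "3 \<le> t \<and> 2 \<le> x \<and> x \<le> t"
  then have "1 \<le> t" "1 \<le> t - 1" "1 \<le> t - 2" "1 \<le> x" "1 \<le> x - 1" "3 \<le> t" "2 \<le> x" "x \<le> t"
    by linarith+
  then show "card (D t x) = card (D (t - 1) (x - 1)) + card (D (t - 2) (x - 1))"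
    using card_D_eq_card_blocks[of t x] card_D_eq_card_blocks[of "t - 1" "x - 1"]
      card_D_eq_card_blocks[of "t - 2" "x - 1"] card_blocks_recurrence[of t x] by metis
next
  fix t :: nat assume "2 \<le> t"
  then show "card (D t 1) = 1"
    using card_D_eq_card_blocks[of t 1] card_blocks_large_modulus[of 1 t] by simp
next
  fix t x :: nat assume "1 \<le> t \<and> 1 \<le> x \<and> real x \<le> real t / 2"
  then show "card (D t x) = 2 ^ (x - 1)"
    by (simp add: card_D_eq_card_blocks card_blocks_large_modulus)
qed (simp_all add: card_D' D_0 card_D_eq_card_blocks blocks_1[simplified] blocks_2)

end
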